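(* Let $C$ be the Conolly sequence: $C(1)=C(2)=1$ and $C(n)=C(n-C(n-1))+C(n-1-C(n-2))$ for $n\ge3$. Define $M_1(1)=M_1(2)=1$ and $M_1(n)=M_1(n-C(n-1))+1$ for $n\ge 3$. Then $M_1$ is slow-growing, and for every $g\ge2$, $\{n : M_1(n)=g\}=[2^{g-1}+1,\,2^g]$.
   Context: A sequence is slow-growing if it is nondecreasing with successive differences in $\{0,1\}$. $M_1$ is the maternal generation sequence of $C$, based on the spot function $S_1(n)=n-C(n-1)$. *)

theory Defs
  imports Main
begin

text \<open>Sequences are indexed from 1 and represented by functions on \<^typ>\<open>nat\<close>; the value at 0
  is a dummy.\<close>

definition slow_growing :: "(nat \<Rightarrow> nat) \<Rightarrow> bool" where
  "slow_growing a \<longleftrightarrow> (\<forall>n\<ge>1. a n \<le> a (n + 1) \<and> a (n + 1) - a n \<in> {0, 1})"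

text \<open>The recursion is nested, so termination rests on positivity of the values. That it never
  refers to the dummy value at 0, and that no subtraction is truncated, is
  \<open>conolly_args\<close> below.\<close>

function conolly :: "nat \<Rightarrow> nat" where
  "conolly n = (if n \<le> 2 then 1
     else conolly (n - conolly (n - 1)) + conolly (n - 1 - conolly (n - 2)))"
  by pat_completeness auto

lemma conolly_dom_pos: "conolly_dom n \<Longrightarrow> conolly n \<ge> 1"
  by (induction n rule: conolly.pinduct) (auto simp: conolly.psimps)

termination
  by (relation "measure id") (auto dest: conolly_dom_pos)

declare conolly.simps [simp del]

lemma conolly_1 [simp]: "conolly 1 = 1" and conolly_2 [simp]: "conolly 2 = 1"
  by (simp_all add: conolly.simps)

lemma conolly_rec:
  "n \<ge> 3 \<Longrightarrow> conolly n = conolly (n - conolly (n - 1)) + conolly (n - 1 - conolly (n - 2))"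
  by (subst conolly.simps) simp

lemma conolly_pos: "conolly n \<ge> 1"
  by (induction n rule: conolly.induct) (subst conolly.simps, auto)

lemma conolly_step_less:
  "n \<ge> 2 \<Longrightarrow> conolly n < n \<and> (conolly n = conolly (n - 1) \<or> conolly n = conolly (n - 1) + 1)"
proof (induction n rule: less_induct)
  case (less n)
  define b where "b = (\<lambda>m. conolly (m - conolly (m - 1)))"
  have rec: "conolly m = b m + b (m - 1)" if "m \<ge> 3" for m
    using conolly_rec[OF that] by (simp add: b_def numeral_2_eq_2)
  have b_step: "b m = b (m - 1) \<or> (b m = b (m - 1) + 1 \<and> conolly (m - 1) = conolly (m - 2))"
    if m: "3 \<le> m" "m \<le> n" for m
  proof -
    have IH: "conolly (m - 1) < m - 1"
      "conolly (m - 1) = conolly (m - 2) \<or> conolly (m - 1) = conolly (m - 2) + 1"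
      using less.IH[of "m - 1"] m by (auto simp: numeral_2_eq_2)
    have pos: "conolly (m - 1) \<ge> 1" by (rule conolly_pos)
    show ?thesis
    proof (cases "conolly (m - 1) = conolly (m - 2)")
      case True
      let ?k = "m - conolly (m - 1)"
      have "?k < n" "?k \<ge> 2" using IH pos m by auto
      then have "conolly ?k = conolly (?k - 1) \<or> conolly ?k = conolly (?k - 1) + 1"
        using less.IH by blast
      moreover have "b (m - 1) = conolly (?k - 1)"
        using True by (simp add: b_def numeral_2_eq_2)
      ultimately show ?thesis using True by (simp add: b_def)
    next
      case False
      then have "m - 1 - conolly (m - 2) = m - conolly (m - 1)" using IH by auto
      then show ?thesis by (simp add: b_def numeral_2_eq_2)
    qed
  qed
  consider "n = 2" | "n = 3" | "n = 4" | "n \<ge> 5" using less.prems by linarith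
  then show ?case
  proof cases
    case 1
    then show ?thesis using conolly_1 conolly_2 by simp
  next
    case 2
    then show ?thesis by (simp add: conolly.simps)
  next
    case 3
    then show ?thesis by (simp add: conolly.simps)
  next
    case 4
    have s: "conolly n = b n + b (n - 1)" "conolly (n - 1) = b (n - 1) + b (n - 2)"
      using rec[of n] rec[of "n - 1"] 4 by (simp_all add: numeral_2_eq_2)
    have "n - 2 - 1 = n - 3" by simp
    then have "conolly (n - 2) = b (n - 2) + b (n - 3)"
      using rec[of "n - 2"] 4 by simp
    moreover have "b n = b (n - 1) \<or> (b n = b (n - 1) + 1 \<and> conolly (n - 1) = conolly (n - 2))"
      using b_step[of n] 4 by simp
    moreover have "b (n - 1) = b (n - 2) \<or> b (n - 1) = b (n - 2) + 1"
      using b_step[of "n - 1"] 4 by (auto simp: numeral_2_eq_2)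
    moreover have "b (n - 2) = b (n - 3) \<or> b (n - 2) = b (n - 3) + 1"
      using b_step[of "n - 2"] 4 \<open>n - 2 - 1 = n - 3\<close> by auto
    ultimately have "conolly n = conolly (n - 1) \<or> conolly n = conolly (n - 1) + 1"
      using s by auto
    moreover have "conolly (n - 1) < n - 1" using less.IH[of "n - 1"] 4 by auto
    ultimately show ?thesis by auto
  qed
qed

lemma conolly_args:
  assumes "n \<ge> 3"
  shows "conolly (n - 1) < n" "n - conolly (n - 1) \<in> {1..<n}"
    and "conolly (n - 2) < n - 1" "n - 1 - conolly (n - 2) \<in> {1..<n}"
proof -
  have a: "conolly (n - 1) < n - 1" using conolly_step_less[of "n - 1"] assms by auto
  have b: "conolly (n - 2) < n - 1"
  proof (cases "n = 3")
    case True
    then show ?thesis using conolly_1 by simp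
  next
    case False
    then have "2 \<le> n - 2" using assms by linarith
    then show ?thesis using conolly_step_less[of "n - 2"] by linarith
  qed
  show "conolly (n - 1) < n" "n - conolly (n - 1) \<in> {1..<n}"
    "conolly (n - 2) < n - 1" "n - 1 - conolly (n - 2) \<in> {1..<n}"
    using a b conolly_pos[of "n - 1"] conolly_pos[of "n - 2"] assms by auto
qed

function M1 :: "nat \<Rightarrow> nat" where
  "M1 n = (if n \<le> 2 then 1 else M1 (n - conolly (n - 1)) + 1)"
  by pat_completeness auto
termination
proof (relation "measure id")
  fix n :: nat
  assume "\<not> n \<le> 2"
  then show "(n - conolly (n - 1), n) \<in> measure id"
    using conolly_pos[of "n - 1"] by simp
qed simp

declare M1.simps [simp del]

end

theory Submission
  imports Defs
begin

text \<open>On the block following a power of two the Conolly sequence repeats itself with a shift: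
  \<open>C(2^k + j) = 2^(k-1) + C(j + 1)\<close> for \<open>1 \<le> j < 2^k\<close>. Together with
  \<open>C(2^k - 1) = C(2^k) = 2^(k-1)\<close> this is stable under \<open>k \<mapsto> k + 1\<close>. Hence the spot function
  \<open>n - C(n - 1)\<close>, which is nondecreasing, maps the endpoints of \<open>[2^k + 1, 2^(k+1)]\<close> to those of
  \<open>[2^(k-1) + 1, 2^k]\<close>, so each of these blocks is one generation.\<close>

text \<open>Each step from index 2 on raises \<open>conolly\<close> by at most 1. Anchored at a
  known value, this bounds later values from above and earlier ones from below.\<close>

lemma conolly_growth:
  assumes "1 \<le> a" "a \<le> b"
  shows "conolly b \<le> conolly a + (b - a)"
  using assms(2)
proof (induction b rule: dec_induct)
  case (step n)
  then show ?case using conolly_step_less[of "Suc n"] assms(1) by auto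
qed simp

text \<open>Here \<open>h\<close> stands for \<open>2^(k-1)\<close>.\<close>

definition conolly_block :: "nat \<Rightarrow> bool" where
  "conolly_block h \<longleftrightarrow> conolly (2 * h - 1) = h \<and> conolly (2 * h) = h \<and>
     (\<forall>j. 1 \<le> j \<and> j < 2 * h \<longrightarrow> conolly (2 * h + j) = h + conolly (j + 1))"

text \<open>The induction starts at 2 because the doubling step reads the shift at offset
  \<open>2 * h - 2\<close>, which must be positive.\<close>

lemma conolly_block_2: "conolly_block 2"
proof -
  have c: "conolly 3 = 2" "conolly 4 = 2" "conolly 5 = 3" "conolly 6 = 4" "conolly 7 = 4"
    by (simp_all add: conolly.simps)
  have "conolly (4 + j) = 2 + conolly (j + 1)" if "1 \<le> j" "j < 4" for j
  proof -
    consider "j = 1" | "j = 2" | "j = 3" using \<open>1 \<le> j\<close> \<open>j < 4\<close> by linarith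
    then show ?thesis using c conolly_2[unfolded numeral_2_eq_2] by cases simp_all
  qed
  then show ?thesis using c by (simp add: conolly_block_def)
qed

text \<open>For \<open>3 \<le> j\<close> both arguments of the recursion at \<open>4 * h + j\<close>
  fall at offsets where the old shift applies, and the shifted values recombine by the recursion at
  \<open>j + 1\<close>.\<close>

lemma conolly_block_double:
  assumes h: "2 \<le> h" and block: "conolly_block h"
  shows "conolly_block (2 * h)"
proof -
  have pred: "conolly (2 * h - 1) = h" and self: "conolly (2 * h) = h"
    and shift: "\<And>j. 1 \<le> j \<Longrightarrow> j < 2 * h \<Longrightarrow> conolly (2 * h + j) = h + conolly (j + 1)"
    using block by (auto simp: conolly_block_def)
  have "2 * h + (2 * h - 1) = 4 * h - 1" "2 * h - 1 + 1 = 2 * h"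
    "2 * h + (2 * h - 2) = 4 * h - 2" "2 * h - 2 + 1 = 2 * h - 1"
    using h by auto
  then have pred2: "conolly (4 * h - 1) = 2 * h" and "conolly (4 * h - 2) = 2 * h"
    using shift[of "2 * h - 1"] shift[of "2 * h - 2"] pred self h by auto
  moreover have "4 * h - 2 * h = 2 * h" "4 * h - 1 - 2 * h = 2 * h - 1"
    using h by auto
  ultimately have self2: "conolly (4 * h) = 2 * h"
    using conolly_rec[of "4 * h"] pred self h by simp
  have next1: "conolly (2 * h + 1) = h + 1"
    using shift[of 1] h conolly_2 by (simp add: numeral_2_eq_2)
  have shift2: "conolly (4 * h + j) = 2 * h + conolly (j + 1)" if "1 \<le> j" "j < 4 * h" for j
    using that
  proof (induction j rule: less_induct)
    case (less j)
    have c1: "conolly (4 * h + 1) = 2 * h + 1"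
    proof -
      have "4 * h + 1 - 1 = 4 * h" "4 * h + 1 - 2 = 4 * h - 1"
        "4 * h + 1 - 2 * h = 2 * h + 1" "4 * h - 2 * h = 2 * h"
        using h by auto
      then show ?thesis
        using conolly_rec[of "4 * h + 1"] pred2 self2 next1 self h by simp
    qed
    \<comment> \<open>Only from \<open>j = 3\<close> on do both preceding indices have positive
      offset from \<open>4 * h\<close>, as the induction hypothesis requires.\<close>
    consider "j = 1" | "j = 2" | "3 \<le> j" using less.prems by linarith
    then show ?case
    proof cases
      case 1
      then show ?thesis using c1 conolly_2 by (simp add: numeral_2_eq_2)
    next
      case 2
      have e: "4 * h + 2 - 1 = 4 * h + 1" "4 * h + 2 - 2 = 4 * h"
        "4 * h + 2 - (2 * h + 1) = 2 * h + 1" "4 * h + 1 - 2 * h = 2 * h + 1"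
        using h by auto
      have "conolly (4 * h + 2) = 2 * h + 2"
        using conolly_rec[of "4 * h + 2"] h unfolding e c1 self2 next1 by simp
      moreover have "conolly 3 = 2" by (simp add: conolly.simps)
      ultimately show ?thesis using 2 by simp
    next
      case 3
      let ?p = "j - conolly j" and ?q = "j - 1 - conolly (j - 1)"
      have less_arg: "conolly j < j" "conolly (j - 1) < j - 1"
        using conolly_step_less[of j] conolly_step_less[of "j - 1"] 3 by auto
      \<comment> \<open>Growth from \<open>j\<close> up to \<open>4 * h - 1\<close>, where the value
        is \<open>2 * h\<close>, forces \<open>conolly j\<close> to be at least
        \<open>j + 1 - 2 * h\<close>.\<close>
      have p: "1 \<le> ?p" "?p < 2 * h"
        using less_arg conolly_growth[of j "4 * h - 1"] pred2 less.prems by linarith+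
      have q: "1 \<le> ?q" "?q < 2 * h"
        using less_arg conolly_growth[of "j - 1" "4 * h - 1"] pred2 less.prems 3 by linarith+
      have prev: "conolly (4 * h + j - 1) = 2 * h + conolly j"
        "conolly (4 * h + j - 2) = 2 * h + conolly (j - 1)"
        using less.IH[of "j - 1"] less.IH[of "j - 2"] less.prems 3
        by (simp_all add: Suc_diff_le numeral_2_eq_2 numeral_3_eq_3 Suc_diff_Suc)
      have spots: "4 * h + j - (2 * h + conolly j) = 2 * h + ?p"
        "4 * h + j - 1 - (2 * h + conolly (j - 1)) = 2 * h + ?q"
        using less_arg by auto
      have "conolly (4 * h + j) = conolly (2 * h + ?p) + conolly (2 * h + ?q)"
        using conolly_rec[of "4 * h + j"] 3 unfolding prev spots by simp
      also have "\<dots> = 2 * h + (conolly (?p + 1) + conolly (?q + 1))"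
        using shift[OF p] shift[OF q] by simp
      also have "conolly (?p + 1) + conolly (?q + 1) = conolly (j + 1)"
      proof -
        have "j + 1 - 1 = j" "j + 1 - 2 = j - 1" "j + 1 - conolly j = ?p + 1"
          "j - conolly (j - 1) = ?q + 1"
          using less_arg 3 by auto
        then show ?thesis using conolly_rec[of "j + 1"] 3 by simp
      qed
      finally show ?thesis .
    qed
  qed
  show ?thesis
    using pred2 self2 shift2 by (simp add: conolly_block_def)
qed

lemma conolly_block_power: "1 \<le> k \<Longrightarrow> conolly_block (2 ^ k)"
proof (induction k rule: dec_induct)
  case base
  then show ?case using conolly_block_2 by simp
next
  case (step k)
  have "(2::nat) ^ 1 \<le> 2 ^ k" using step by (intro power_increasing) auto
  then show ?case using conolly_block_double[of "2 ^ k"] step by simp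
qed

lemma conolly_power: "conolly (2 ^ (k + 1)) = 2 ^ k"
proof (cases "k = 0")
  case False
  then show ?thesis using conolly_block_power[of k] by (simp add: conolly_block_def)
qed (use conolly_2 in simp)

lemma conolly_power_minus_one: "1 \<le> k \<Longrightarrow> conolly (2 ^ (k + 1) - 1) = 2 ^ k"
  using conolly_block_power[of k] by (simp add: conolly_block_def)

text \<open>The index \<open>n - 1\<close> lies between \<open>2 ^ k\<close> and
  \<open>2 ^ (k + 1) - 1\<close>, where \<open>conolly\<close> is known. Growth from the left end
  gives the lower bound, growth to the right end the upper one.\<close>

lemma spot_bounds:
  assumes "1 \<le> k" and n: "2 ^ k < n" "n \<le> 2 ^ (k + 1)"
  shows "2 ^ (k - 1) < n - conolly (n - 1)" "n - conolly (n - 1) \<le> 2 ^ k"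
proof -
  obtain i where k: "k = i + 1" using assms(1) by (metis add.commute le_Suc_ex plus_1_eq_Suc)
  have pos: "(1::nat) \<le> 2 ^ i" by simp
  have low: "conolly (n - 1) \<le> 2 ^ i + (n - 1 - 2 ^ k)"
    using conolly_growth[of "2 ^ k" "n - 1"] conolly_power[of i] n k by auto
  have high: "2 ^ k \<le> conolly (n - 1) + (2 ^ (k + 1) - n)"
    using conolly_growth[of "n - 1" "2 ^ (k + 1) - 1"] conolly_power_minus_one[OF assms(1)] n pos k
    by simp
  show "2 ^ (k - 1) < n - conolly (n - 1)" "n - conolly (n - 1) \<le> 2 ^ k"
    using low high n pos k by auto
qed

text \<open>By \<open>spot_bounds\<close> the spot of \<open>n\<close> lies in the preceding block,
  so each block adds one generation. The block for \<open>k = 0\<close> is just 2, an initial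
  value.\<close>

lemma M1_block: "2 ^ k < n \<Longrightarrow> n \<le> 2 ^ (k + 1) \<Longrightarrow> M1 n = k + 1"
proof (induction k arbitrary: n)
  case 0
  then show ?case by (simp add: M1.simps)
next
  case (Suc k)
  have "(1::nat) \<le> 2 ^ k" by simp
  moreover have "2 * 2 ^ k < n" using Suc.prems by simp
  ultimately have "2 < n" by linarith
  then have "M1 n = M1 (n - conolly (n - 1)) + 1" by (subst M1.simps) simp
  then show ?case using Suc.IH spot_bounds[of "Suc k" n] Suc.prems by simp
qed

lemma power_block_exists:
  fixes n :: nat
  assumes "2 \<le> n"
  obtains k where "2 ^ k < n" "n \<le> 2 ^ (k + 1)"
proof -
  have "\<exists>k. 2 ^ k < n \<and> n \<le> 2 ^ (k + 1)"
    using assms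
  proof (induction n rule: dec_induct)
    case base
    show ?case by (rule exI[of _ 0]) simp
  next
    case (step n)
    then obtain k where k: "2 ^ k < n" "n \<le> 2 ^ (k + 1)" by blast
    show ?case
    proof (cases "n = 2 ^ (k + 1)")
      case True
      then show ?thesis using step by (intro exI[of _ "k + 1"]) simp
    next
      case False
      then show ?thesis using k by (intro exI[of _ k]) simp
    qed
  qed
  then show ?thesis using that by blast
qed

theorem mainTheorem6:
  "slow_growing M1 \<and> (\<forall>g\<ge>2. {n. n \<ge> 1 \<and> M1 n = g} = {2 ^ (g - 1) + 1..2 ^ g})"
proof (intro conjI allI impI)
  have M1_1: "M1 1 = 1" and M1_2: "M1 2 = 1" by (simp_all add: M1.simps)
  have "M1 (n + 1) = M1 n \<or> M1 (n + 1) = M1 n + 1" if "1 \<le> n" for n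
  proof (cases "n = 1")
    case True
    then show ?thesis using M1_1 M1_2 by (simp add: numeral_2_eq_2)
  next
    case False
    then obtain k where k: "2 ^ k < n" "n \<le> 2 ^ (k + 1)"
      using \<open>1 \<le> n\<close> power_block_exists[of n] by (metis Suc_1 Suc_leI le_neq_implies_less)
    show ?thesis
    \<comment> \<open>Only the right end of a block has its successor in the next one.\<close>
    proof (cases "n = 2 ^ (k + 1)")
      case True
      then show ?thesis using M1_block[OF k] M1_block[of "k + 1" "n + 1"] that by simp
    next
      case False
      then show ?thesis using M1_block[OF k] M1_block[of k "n + 1"] k by simp
    qed
  qed
  then show "slow_growing M1" unfolding slow_growing_def by fastforce
next
  fix g :: nat
  assume g: "2 \<le> g"
  show "{n. n \<ge> 1 \<and> M1 n = g} = {2 ^ (g - 1) + 1..2 ^ g}"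
  proof (intro set_eqI iffI)
    fix n assume "n \<in> {n. n \<ge> 1 \<and> M1 n = g}"
    then have n: "1 \<le> n" "M1 n = g" by auto
    \<comment> \<open>The index 1 lies in no block; it shares generation 1 with 2, which
      \<open>g\<close> excludes.\<close>
    then have "n \<noteq> 1" using g by (auto simp: M1.simps)
    then obtain k where k: "2 ^ k < n" "n \<le> 2 ^ (k + 1)"
      using n power_block_exists[of n] by (metis Suc_1 Suc_leI le_neq_implies_less)
    then have "g = k + 1" using M1_block n by simp
    then show "n \<in> {2 ^ (g - 1) + 1..2 ^ g}" using k by simp
  next
    fix n :: nat assume "n \<in> {2 ^ (g - 1) + 1..2 ^ g}"
    then show "n \<in> {n. n \<ge> 1 \<and> M1 n = g}" using M1_block[of "g - 1" n] g by auto
  qed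
qed

end
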